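(* For any based spaces $(X,x_0)$ and $(Y,y_0)$, the homomorphism $\phi:\pi_1^{\tau}(X\times Y,(x_0,y_0))\to\pi_1^{\tau}(X,x_0)\times\pi_1^{\tau}(Y,y_0)$ induced by the two projections, $\phi([(\alpha,\beta)])=([\alpha],[\beta])$, is a natural isomorphism of topological groups (the target carrying the product topology).
   Context: $\Omega(Z,z)$ is the loop space with the compact-open topology; $\pi_1^{qtop}(Z,z)$ is $\pi_1(Z,z)$ with the quotient topology via $\alpha\mapsto[\alpha]$. $F_M(S)$ is the free (Markov) topological group on a space $S$. For a group with topology $G$, $\tau(G)$ is $G$ with the quotient topology with respect to the multiplication epimorphism $m_G:F_M(G)\to G$ (generator $g\mapsto g$). $\pi_1^{\tau}=\tau\circ\pi_1^{qtop}$. *)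

theory Defs
  imports "HOL-Analysis.Analysis" "HOL-Algebra.Group"
begin

definition quotient_topology :: "'a topology \<Rightarrow> ('a \<Rightarrow> 'b) \<Rightarrow> 'b topology" where
  "quotient_topology X f =
     topology (\<lambda>U. U \<subseteq> f ` topspace X \<and> openin X {x \<in> topspace X. f x \<in> U})"

definition loops :: "'a topology \<Rightarrow> 'a \<Rightarrow> (real \<Rightarrow> 'a) set" where
  "loops X x = {\<alpha>. pathin X \<alpha> \<and> \<alpha> 0 = x \<and> \<alpha> 1 = x}"

text \<open>Compact-open topology on the loops: generated by the subbasis sets
  \<open>{\<alpha>. \<alpha>(K) \<subseteq> W}\<close>, \<open>K\<close> compact in \<open>[0,1]\<close>, \<open>W\<close> open in \<open>X\<close>.\<close>
definition loop_space :: "'a topology \<Rightarrow> 'a \<Rightarrow> (real \<Rightarrow> 'a) topology" where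
  "loop_space X x = topology (\<lambda>U. \<exists>\<U>. U = \<Union>\<U> \<and>
     (\<forall>V\<in>\<U>. \<exists>\<F>. finite \<F> \<and>
        \<F> \<subseteq> {{\<alpha> \<in> loops X x. \<alpha> ` K \<subseteq> W} | K W.
                compactin (top_of_set {0..1::real}) K \<and> openin X W} \<and>
        V = loops X x \<inter> \<Inter>\<F>))"

definition loop_homotopic :: "'a topology \<Rightarrow> 'a \<Rightarrow> (real \<Rightarrow> 'a) \<Rightarrow> (real \<Rightarrow> 'a) \<Rightarrow> bool" where
  "loop_homotopic X x \<alpha> \<beta> =
     homotopic_with (\<lambda>r. r 0 = x \<and> r 1 = x) (top_of_set {0..1}) X \<alpha> \<beta>"

definition loop_class :: "'a topology \<Rightarrow> 'a \<Rightarrow> (real \<Rightarrow> 'a) \<Rightarrow> (real \<Rightarrow> 'a) set" where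
  "loop_class X x \<alpha> = {\<beta> \<in> loops X x. loop_homotopic X x \<alpha> \<beta>}"

definition loop_join :: "(real \<Rightarrow> 'a) \<Rightarrow> (real \<Rightarrow> 'a) \<Rightarrow> real \<Rightarrow> 'a" where
  "loop_join \<alpha> \<beta> = (\<lambda>t. if t \<le> 1/2 then \<alpha> (2 * t) else \<beta> (2 * t - 1))"

definition fundamental_group :: "'a topology \<Rightarrow> 'a \<Rightarrow> (real \<Rightarrow> 'a) set monoid" where
  "fundamental_group X x =
     \<lparr>carrier = loop_class X x ` loops X x,
      mult = (\<lambda>A B. {\<gamma> \<in> loops X x. \<exists>\<alpha>\<in>A. \<exists>\<beta>\<in>B. loop_homotopic X x (loop_join \<alpha> \<beta>) \<gamma>}),
      one = loop_class X x (\<lambda>t. x)\<rparr>"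

definition pi1_qtop :: "'a topology \<Rightarrow> 'a \<Rightarrow> (real \<Rightarrow> 'a) set topology" where
  "pi1_qtop X x = quotient_topology (loop_space X x) (loop_class X x)"

definition group_topology :: "('g, 'm) monoid_scheme \<Rightarrow> 'g topology \<Rightarrow> bool" where
  "group_topology G T \<longleftrightarrow> group G \<and> topspace T = carrier G \<and>
     continuous_map (prod_topology T T) T (\<lambda>(a, b). a \<otimes>\<^bsub>G\<^esub> b) \<and>
     continuous_map T T (\<lambda>a. inv\<^bsub>G\<^esub> a)"

text \<open>Free group on a set \<open>S\<close>: reduced words of letters \<open>(s, True)\<close> (= \<open>s\<close>)
  and \<open>(s, False)\<close> (= \<open>s\<^sup>-\<^sup>1\<close>).\<close>
definition word_reduce :: "('a \<times> bool) list \<Rightarrow> ('a \<times> bool) list" where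
  "word_reduce xs = foldr (\<lambda>x acc. case acc of [] \<Rightarrow> [x]
      | y # ys \<Rightarrow> (if fst x = fst y \<and> snd x \<noteq> snd y then ys else x # acc)) xs []"

definition reduced_word :: "('a \<times> bool) list \<Rightarrow> bool" where
  "reduced_word w \<longleftrightarrow> (\<forall>i. Suc i < length w \<longrightarrow>
      \<not> (fst (w ! i) = fst (w ! Suc i) \<and> snd (w ! i) \<noteq> snd (w ! Suc i)))"

definition free_group :: "'a set \<Rightarrow> ('a \<times> bool) list monoid" where
  "free_group S = \<lparr>carrier = {w. set w \<subseteq> S \<times> UNIV \<and> reduced_word w},
                   mult = (\<lambda>v w. word_reduce (v @ w)),
                   one = []\<rparr>"

definition free_gen :: "'a \<Rightarrow> ('a \<times> bool) list" where
  "free_gen s = [(s, True)]"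

definition markov_topology :: "'a topology \<Rightarrow> ('a \<times> bool) list topology" where
  "markov_topology S = (THE T. group_topology (free_group (topspace S)) T \<and>
      continuous_map S T free_gen \<and>
      (\<forall>T'. group_topology (free_group (topspace S)) T' \<and> continuous_map S T' free_gen
            \<longrightarrow> (\<forall>U. openin T' U \<longrightarrow> openin T U)))"

definition mult_word :: "('g, 'm) monoid_scheme \<Rightarrow> ('g \<times> bool) list \<Rightarrow> 'g" where
  "mult_word G w = foldr (\<lambda>(g, b) acc. (if b then g else inv\<^bsub>G\<^esub> g) \<otimes>\<^bsub>G\<^esub> acc) w \<one>\<^bsub>G\<^esub>"

definition tau_topology :: "('g, 'm) monoid_scheme \<Rightarrow> 'g topology \<Rightarrow> 'g topology" where
  "tau_topology G T = quotient_topology (markov_topology T) (mult_word G)"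

definition pi1_tau :: "'a topology \<Rightarrow> 'a \<Rightarrow> (real \<Rightarrow> 'a) set topology" where
  "pi1_tau X x = tau_topology (fundamental_group X x) (pi1_qtop X x)"

end

theory Submission
  imports Defs
begin

text \<open>
  Algebraically, \<open>\<phi> = (fst\<^sub>*, snd\<^sub>*)\<close> has the inverse
  \<open>\<psi>(a, b) = (i\<^sub>X)\<^sub>* a \<cdot> (i\<^sub>Y)\<^sub>* b\<close> with \<open>i\<^sub>X x = (x, y\<^sub>0)\<close>, \<open>i\<^sub>Y y = (x\<^sub>0, y)\<close>:
  a loop \<open>(\<alpha>, \<beta>)\<close> is homotopic, componentwise, to \<open>(\<alpha> \<cdot> c, c \<cdot> \<beta>)\<close>.
  Topologically, \<open>\<tau>(G)\<close> is the finest group topology coarser than the topology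
  of \<open>G\<close>, so \<open>\<tau>\<close> is functorial: every continuous homomorphism stays continuous
  after applying \<open>\<tau>\<close>.  Hence \<open>fst\<^sub>*, snd\<^sub>*, (i\<^sub>X)\<^sub>*, (i\<^sub>Y)\<^sub>*\<close> are
  \<open>\<tau>\<close>-continuous, so is \<open>\<phi>\<close>, and so is \<open>\<psi>\<close> because multiplication is continuous
  in the topological group \<open>\<pi>\<^sub>1\<^sup>\<tau>(X \<times> Y)\<close>.
\<close>

section \<open>Free groups\<close>

definition cancels :: "('a \<times> bool) \<Rightarrow> ('a \<times> bool) \<Rightarrow> bool" where
  "cancels x y \<longleftrightarrow> fst x = fst y \<and> snd x \<noteq> snd y"

definition push_letter :: "('a \<times> bool) \<Rightarrow> ('a \<times> bool) list \<Rightarrow> ('a \<times> bool) list" where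
  "push_letter x w = (case w of [] \<Rightarrow> [x] | y # ys \<Rightarrow> (if cancels x y then ys else x # w))"

definition letter_inv :: "('a \<times> bool) \<Rightarrow> ('a \<times> bool)" where
  "letter_inv x = (fst x, \<not> snd x)"

lemma letter_inv_inv [simp]: "letter_inv (letter_inv x) = x"
  by (simp add: letter_inv_def)

lemma cancels_iff_inv: "cancels x y \<longleftrightarrow> y = letter_inv x"
  by (cases x, cases y) (auto simp: cancels_def letter_inv_def)

lemma word_reduce_foldr: "word_reduce xs = foldr push_letter xs []"
  unfolding word_reduce_def push_letter_def cancels_def
  by (rule arg_cong[where f="\<lambda>f. foldr f xs []"]) (auto simp: fun_eq_iff)

lemma reduced_word_Nil [simp]: "reduced_word []"
  by (simp add: reduced_word_def)

lemma reduced_word_Cons: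
  "reduced_word (x # w) \<longleftrightarrow> reduced_word w \<and> (w \<noteq> [] \<longrightarrow> \<not> cancels x (hd w))"
proof
  assume r: "reduced_word (x # w)"
  have "reduced_word w"
    unfolding reduced_word_def
  proof (intro allI impI)
    fix i assume "Suc i < length w"
    with r[unfolded reduced_word_def, rule_format, of "Suc i"]
    show "\<not> (fst (w ! i) = fst (w ! Suc i) \<and> snd (w ! i) \<noteq> snd (w ! Suc i))" by simp
  qed
  moreover have "w \<noteq> [] \<longrightarrow> \<not> cancels x (hd w)"
    using r[unfolded reduced_word_def, rule_format, of 0] by (cases w) (auto simp: cancels_def)
  ultimately show "reduced_word w \<and> (w \<noteq> [] \<longrightarrow> \<not> cancels x (hd w))" by blast
next
  assume r: "reduced_word w \<and> (w \<noteq> [] \<longrightarrow> \<not> cancels x (hd w))"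
  show "reduced_word (x # w)"
    unfolding reduced_word_def
  proof (intro allI impI)
    fix i assume i: "Suc i < length (x # w)"
    show "\<not> (fst ((x # w) ! i) = fst ((x # w) ! Suc i) \<and> snd ((x # w) ! i) \<noteq> snd ((x # w) ! Suc i))"
      using r i unfolding reduced_word_def by (cases i; cases w) (auto simp: cancels_def)
  qed
qed

lemma push_letter_reduced: "reduced_word w \<Longrightarrow> reduced_word (push_letter x w)"
  by (cases w) (auto simp: push_letter_def reduced_word_Cons)

lemma foldr_push_reduced: "reduced_word acc \<Longrightarrow> reduced_word (foldr push_letter w acc)"
  by (induction w) (auto simp: push_letter_reduced)

lemma push_letter_set: "set (push_letter x w) \<subseteq> insert x (set w)"
  by (cases w) (auto simp: push_letter_def)

lemma foldr_push_set: "set (foldr push_letter w acc) \<subseteq> set w \<union> set acc"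
  by (induction w) (use push_letter_set in fastforce)+

lemma push_letter_cancel:
  assumes "reduced_word w"
  shows "push_letter (letter_inv x) (push_letter x w) = w"
proof (cases w)
  case Nil then show ?thesis by (simp add: push_letter_def cancels_def letter_inv_def)
next
  case (Cons y ys)
  show ?thesis
  proof (cases "cancels x y")
    case True
    then have "y = letter_inv x" by (simp add: cancels_iff_inv)
    moreover have "ys \<noteq> [] \<Longrightarrow> \<not> cancels y (hd ys)"
      using assms Cons by (simp add: reduced_word_Cons)
    ultimately show ?thesis using Cons True
      by (cases ys) (auto simp: push_letter_def cancels_iff_inv)
  next
    case False
    then have "push_letter x w = x # w" using Cons by (simp add: push_letter_def)
    then show ?thesis by (simp add: push_letter_def cancels_def letter_inv_def)
  qed
qed

lemma reduced_word_fixed: "reduced_word w \<Longrightarrow> foldr push_letter w [] = w"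
proof (induction w)
  case (Cons x w)
  then have "reduced_word w" "w \<noteq> [] \<longrightarrow> \<not> cancels x (hd w)" by (auto simp: reduced_word_Cons)
  with Cons show ?case by (cases w) (auto simp: push_letter_def)
qed simp

lemma foldr_push_letter:
  assumes "reduced_word w" "reduced_word acc"
  shows "foldr push_letter (push_letter x w) acc = push_letter x (foldr push_letter w acc)"
proof (cases w)
  case (Cons y ys)
  show ?thesis
  proof (cases "cancels x y")
    case True
    then have "x = letter_inv y" by (simp add: cancels_iff_inv)
    moreover have "reduced_word (foldr push_letter ys acc)"
      using assms by (intro foldr_push_reduced)
    ultimately show ?thesis using Cons True push_letter_cancel[of _ y]
      by (simp add: push_letter_def)
  qed (use Cons in \<open>simp add: push_letter_def\<close>)
qed (simp add: push_letter_def)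

lemma foldr_push_assoc:
  assumes "reduced_word v" "reduced_word w"
  shows "foldr push_letter (foldr push_letter u v) w = foldr push_letter u (foldr push_letter v w)"
  using assms
  by (induction u) (simp_all add: foldr_push_letter foldr_push_reduced)

lemma foldr_push_inverse:
  assumes "reduced_word w"
  shows "foldr push_letter (rev (map letter_inv u)) (foldr push_letter u w) = w"
  using assms
  by (induction u) (simp_all add: push_letter_cancel foldr_push_reduced)

lemma free_group_mult:
  "reduced_word w \<Longrightarrow> v \<otimes>\<^bsub>free_group S\<^esub> w = foldr push_letter v w"
  by (simp add: free_group_def word_reduce_foldr reduced_word_fixed)

lemma free_group_is_group: "group (free_group S)"
proof (rule groupI)
  let ?F = "free_group S"
  show "x \<otimes>\<^bsub>?F\<^esub> y \<in> carrier ?F" if "x \<in> carrier ?F" "y \<in> carrier ?F" for x y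
  proof -
    have "reduced_word y" using that by (simp add: free_group_def)
    then show ?thesis using that foldr_push_set[of x y] foldr_push_reduced[of y x]
      by (auto simp: free_group_mult) (auto simp: free_group_def)
  qed
  show "\<one>\<^bsub>?F\<^esub> \<in> carrier ?F" by (simp add: free_group_def)
  show "x \<otimes>\<^bsub>?F\<^esub> y \<otimes>\<^bsub>?F\<^esub> z = x \<otimes>\<^bsub>?F\<^esub> (y \<otimes>\<^bsub>?F\<^esub> z)"
    if "x \<in> carrier ?F" "y \<in> carrier ?F" "z \<in> carrier ?F" for x y z
  proof -
    have "reduced_word y" "reduced_word z" using that by (simp_all add: free_group_def)
    then show ?thesis by (simp add: free_group_mult foldr_push_assoc foldr_push_reduced)
  qed
  show "\<one>\<^bsub>?F\<^esub> \<otimes>\<^bsub>?F\<^esub> x = x" if "x \<in> carrier ?F" for x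
    using that by (simp add: free_group_def word_reduce_foldr reduced_word_fixed)
  show "\<exists>y\<in>carrier ?F. y \<otimes>\<^bsub>?F\<^esub> x = \<one>\<^bsub>?F\<^esub>" if x: "x \<in> carrier ?F" for x
  proof
    let ?y = "foldr push_letter (rev (map letter_inv x)) []"
    have x': "reduced_word x" "set x \<subseteq> S \<times> UNIV" using x by (auto simp: free_group_def)
    then have "set (rev (map letter_inv x)) \<subseteq> S \<times> UNIV" by (auto simp: letter_inv_def)
    then show "?y \<in> carrier ?F"
      using foldr_push_set[of "rev (map letter_inv x)" "[]"] foldr_push_reduced[of "[]"]
      by (simp add: free_group_def) blast
    have "?y \<otimes>\<^bsub>?F\<^esub> x = foldr push_letter (rev (map letter_inv x)) (foldr push_letter x [])"
      using x' foldr_push_assoc[of "[]" x] by (simp add: free_group_mult reduced_word_fixed)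
    then show "?y \<otimes>\<^bsub>?F\<^esub> x = \<one>\<^bsub>?F\<^esub>" by (simp add: foldr_push_inverse free_group_def)
  qed
qed

lemma free_gen_carrier: "g \<in> S \<Longrightarrow> free_gen g \<in> carrier (free_group S)"
  by (simp add: free_gen_def free_group_def reduced_word_def)

definition letter_value :: "('g, 'm) monoid_scheme \<Rightarrow> ('g \<times> bool) \<Rightarrow> 'g" where
  "letter_value G x = (if snd x then fst x else inv\<^bsub>G\<^esub> (fst x))"

lemma mult_word_Nil [simp]: "mult_word G [] = \<one>\<^bsub>G\<^esub>"
  by (simp add: mult_word_def)

lemma mult_word_Cons [simp]: "mult_word G (x # w) = letter_value G x \<otimes>\<^bsub>G\<^esub> mult_word G w"
  by (cases x) (simp add: mult_word_def letter_value_def)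

context group begin

lemma letter_value_closed: "fst x \<in> carrier G \<Longrightarrow> letter_value G x \<in> carrier G"
  by (simp add: letter_value_def)

lemma mult_word_closed: "set w \<subseteq> carrier G \<times> UNIV \<Longrightarrow> mult_word G w \<in> carrier G"
  by (induction w) (auto simp: letter_value_closed)

lemma mult_word_push_letter:
  assumes "fst x \<in> carrier G" "set w \<subseteq> carrier G \<times> UNIV"
  shows "mult_word G (push_letter x w) = letter_value G x \<otimes> mult_word G w"
proof (cases w)
  case (Cons y ys)
  show ?thesis
  proof (cases "cancels x y")
    case True
    then have "letter_value G x \<otimes> letter_value G y = \<one>"
      using assms(1) by (auto simp: cancels_iff_inv letter_value_def letter_inv_def)
    moreover have "mult_word G ys \<in> carrier G" "letter_value G y \<in> carrier G"
      using assms Cons by (auto intro!: mult_word_closed letter_value_closed)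
    ultimately show ?thesis using Cons True assms(1)
      by (simp add: push_letter_def m_assoc[symmetric] letter_value_closed)
  qed (use Cons in \<open>simp add: push_letter_def\<close>)
qed (use assms in \<open>simp add: push_letter_def letter_value_closed\<close>)

lemma mult_word_foldr_push:
  assumes "set v \<subseteq> carrier G \<times> UNIV" "set w \<subseteq> carrier G \<times> UNIV"
  shows "mult_word G (foldr push_letter v w) = mult_word G v \<otimes> mult_word G w"
  using assms
proof (induction v)
  case (Cons x v)
  have "set (foldr push_letter v w) \<subseteq> carrier G \<times> UNIV"
    using foldr_push_set[of v w] Cons.prems by auto
  then show ?case using Cons
    by (auto simp: mem_Times_iff mult_word_push_letter m_assoc letter_value_closed mult_word_closed)
qed (simp add: mult_word_closed)

lemma mult_word_hom: "mult_word G \<in> hom (free_group (carrier G)) G"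
proof (rule homI)
  fix v w assume "v \<in> carrier (free_group (carrier G))" "w \<in> carrier (free_group (carrier G))"
  then have "reduced_word w" "set v \<subseteq> carrier G \<times> UNIV" "set w \<subseteq> carrier G \<times> UNIV"
    by (auto simp: free_group_def)
  then show "mult_word G (v \<otimes>\<^bsub>free_group (carrier G)\<^esub> w) = mult_word G v \<otimes> mult_word G w"
    by (simp add: free_group_mult mult_word_foldr_push)
qed (auto simp: free_group_def intro!: mult_word_closed)

lemma mult_word_gen: "g \<in> carrier G \<Longrightarrow> mult_word G (free_gen g) = g"
  by (simp add: free_gen_def letter_value_def)

lemma mult_word_surj: "mult_word G ` carrier (free_group (carrier G)) = carrier G"
proof
  show "mult_word G ` carrier (free_group (carrier G)) \<subseteq> carrier G"
    using mult_word_hom by (auto simp: hom_def)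
  show "carrier G \<subseteq> mult_word G ` carrier (free_group (carrier G))"
    using mult_word_gen free_gen_carrier by (metis image_eqI subsetI)
qed

end

lemma istopology_quotient:
  "istopology (\<lambda>U. U \<subseteq> f ` topspace X \<and> openin X {x \<in> topspace X. f x \<in> U})"
proof -
  have "{x \<in> topspace X. f x \<in> S \<inter> T} = {x \<in> topspace X. f x \<in> S} \<inter> {x \<in> topspace X. f x \<in> T}"
    and "{x \<in> topspace X. f x \<in> \<Union>K} = (\<Union>U\<in>K. {x \<in> topspace X. f x \<in> U})"
    for S T K by auto
  then show ?thesis unfolding istopology_def by auto
qed

lemma openin_quotient_topology:
  "openin (quotient_topology X f) U \<longleftrightarrow> U \<subseteq> f ` topspace X \<and> openin X {x \<in> topspace X. f x \<in> U}"
  unfolding quotient_topology_def topology_inverse'[OF istopology_quotient] by simp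

lemma quotient_map_quotient_topology: "quotient_map X (quotient_topology X f) f"
proof -
  have "{x \<in> topspace X. f x \<in> f ` topspace X} = topspace X" by auto
  then have "openin (quotient_topology X f) (f ` topspace X)"
    by (auto simp: openin_quotient_topology)
  then have "topspace (quotient_topology X f) = f ` topspace X"
    by (metis openin_quotient_topology openin_topspace subset_antisym openin_subset)
  then show ?thesis unfolding quotient_map_def by (auto simp: openin_quotient_topology)
qed

lemma topspace_quotient_topology [simp]: "topspace (quotient_topology X f) = f ` topspace X"
  using quotient_map_quotient_topology by (metis quotient_imp_surjective_map)

lemma continuous_map_quotient_topology: "continuous_map X (quotient_topology X f) f"
  by (rule quotient_imp_continuous_map[OF quotient_map_quotient_topology])

section \<open>Topological groups\<close>

context
  fixes G (structure) and T
  assumes gt: "group_topology G T"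
begin

lemma group_topology_group: "group G"
  using gt by (simp add: group_topology_def)

lemma group_topology_topspace: "topspace T = carrier G"
  using gt by (simp add: group_topology_def)

lemma group_topology_mult: "continuous_map (prod_topology T T) T (\<lambda>(a, b). a \<otimes> b)"
  using gt by (simp add: group_topology_def)

lemma group_topology_inv: "continuous_map T T (\<lambda>a. inv a)"
  using gt by (simp add: group_topology_def)

lemma right_translation_continuous:
  assumes c: "c \<in> carrier G"
  shows "continuous_map T T (\<lambda>x. x \<otimes> c)"
proof -
  have "continuous_map T (prod_topology T T) (\<lambda>x. (x, c))"
    using c group_topology_topspace by (intro continuous_map_pairedI) (auto simp: id_def[symmetric])
  from continuous_map_compose[OF this group_topology_mult] show ?thesis by (simp add: o_def)
qed

lemma right_translation_open:
  assumes U: "openin T U" and c: "c \<in> carrier G"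
  shows "openin T ((\<lambda>x. x \<otimes> c) ` U)"
proof -
  interpret group G by (rule group_topology_group)
  have Uc: "U \<subseteq> carrier G" using openin_subset[OF U] group_topology_topspace by simp
  have "(\<lambda>x. x \<otimes> c) ` U = {x \<in> topspace T. x \<otimes> inv c \<in> U}"
  proof
    show "(\<lambda>x. x \<otimes> c) ` U \<subseteq> {x \<in> topspace T. x \<otimes> inv c \<in> U}"
      using Uc c group_topology_topspace by (auto simp: m_assoc)
    show "{x \<in> topspace T. x \<otimes> inv c \<in> U} \<subseteq> (\<lambda>x. x \<otimes> c) ` U"
    proof
      fix x assume x: "x \<in> {x \<in> topspace T. x \<otimes> inv c \<in> U}"
      then have "x = (x \<otimes> inv c) \<otimes> c" using c group_topology_topspace by (simp add: m_assoc)
      then show "x \<in> (\<lambda>x. x \<otimes> c) ` U" using x by blast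
    qed
  qed
  moreover have "openin T {x \<in> topspace T. x \<otimes> inv c \<in> U}"
    using right_translation_continuous[of "inv c"] c U by (simp add: continuous_map_def)
  ultimately show ?thesis by simp
qed

end

lemma open_map_prod:
  assumes "open_map X X' f" "open_map Y Y' g"
  shows "open_map (prod_topology X Y) (prod_topology X' Y') (\<lambda>(a, b). (f a, g b))"
  unfolding open_map_def
proof (intro allI impI)
  fix W assume W: "openin (prod_topology X Y) W"
  show "openin (prod_topology X' Y') ((\<lambda>(a, b). (f a, g b)) ` W)"
    unfolding openin_prod_topology_alt
  proof (intro allI impI)
    fix x' y' assume "(x', y') \<in> (\<lambda>(a, b). (f a, g b)) ` W"
    then obtain x y where xy: "(x, y) \<in> W" "x' = f x" "y' = g y" by auto
    have h: "\<forall>x y. (x, y) \<in> W \<longrightarrow> (\<exists>U V. openin X U \<and> openin Y V \<and> x \<in> U \<and> y \<in> V \<and> U \<times> V \<subseteq> W)"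
      using W by (simp only: openin_prod_topology_alt)
    obtain U V where UV: "openin X U" "openin Y V" "x \<in> U" "y \<in> V" "U \<times> V \<subseteq> W"
      using h[rule_format, OF xy(1)] by (elim exE conjE) simp
    show "\<exists>U V. openin X' U \<and> openin Y' V \<and> x' \<in> U \<and> y' \<in> V \<and> U \<times> V \<subseteq> (\<lambda>(a, b). (f a, g b)) ` W"
    proof (intro exI conjI)
      show "openin X' (f ` U)" "openin Y' (g ` V)" using assms UV by (auto simp: open_map_def)
      show "x' \<in> f ` U" "y' \<in> g ` V" using xy UV by auto
      show "f ` U \<times> g ` V \<subseteq> (\<lambda>(a, b). (f a, g b)) ` W" using UV by force
    qed
  qed
qed

text \<open>The quotient map onto the image of a surjective homomorphism is open: the
  saturation of an open set \<open>U\<close> is the union of its translates by the kernel.\<close>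
lemma quotient_hom_open_map:
  assumes gt: "group_topology F M" and G: "group G" and q: "q \<in> hom F G"
  shows "open_map M (quotient_topology M q) q"
  unfolding open_map_def
proof (intro allI impI)
  interpret F: group F by (rule group_topology_group[OF gt])
  interpret q: group_hom F G q using q G by (simp add: group_hom_def group_hom_axioms_def F.group_axioms)
  have tsM: "topspace M = carrier F" by (rule group_topology_topspace[OF gt])
  fix U assume U: "openin M U"
  have Uc: "U \<subseteq> carrier F" using openin_subset[OF U] tsM by simp
  let ?K = "{k \<in> carrier F. q k = \<one>\<^bsub>G\<^esub>}"
  have "{x \<in> topspace M. q x \<in> q ` U} \<subseteq> (\<Union>k\<in>?K. (\<lambda>x. x \<otimes>\<^bsub>F\<^esub> k) ` U)"
  proof
    fix x assume "x \<in> {x \<in> topspace M. q x \<in> q ` U}"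
    then obtain u where x: "x \<in> carrier F" and u: "u \<in> U" "q x = q u" using tsM by auto
    then have "inv\<^bsub>F\<^esub> u \<otimes>\<^bsub>F\<^esub> x \<in> ?K" and "x = u \<otimes>\<^bsub>F\<^esub> (inv\<^bsub>F\<^esub> u \<otimes>\<^bsub>F\<^esub> x)"
      using Uc by (auto simp: F.m_assoc[symmetric])
    then show "x \<in> (\<Union>k\<in>?K. (\<lambda>x. x \<otimes>\<^bsub>F\<^esub> k) ` U)" using u by blast
  qed
  moreover have "(\<Union>k\<in>?K. (\<lambda>x. x \<otimes>\<^bsub>F\<^esub> k) ` U) \<subseteq> {x \<in> topspace M. q x \<in> q ` U}"
    using Uc tsM by force
  moreover have "openin M (\<Union>k\<in>?K. (\<lambda>x. x \<otimes>\<^bsub>F\<^esub> k) ` U)"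
    using right_translation_open[OF gt U] by auto
  ultimately show "openin (quotient_topology M q) (q ` U)"
    using openin_subset[OF U] by (auto simp: openin_quotient_topology subset_antisym)
qed

text \<open>A group topology pushed forward along a surjective homomorphism is again a
  group topology; continuity of multiplication uses that the product of two open
  quotient maps is a quotient map.\<close>
lemma quotient_group_topology:
  assumes gt: "group_topology F M" and G: "group G" and q: "q \<in> hom F G"
    and surj: "q ` carrier F = carrier G"
  shows "group_topology G (quotient_topology M q)"
proof -
  let ?Q = "quotient_topology M q"
  interpret F: group F by (rule group_topology_group[OF gt])
  interpret G: group G by (rule G)
  interpret q: group_hom F G q using q by (simp add: group_hom_def group_hom_axioms_def G F.group_axioms)
  have tsM: "topspace M = carrier F" by (rule group_topology_topspace[OF gt])
  have qc: "continuous_map M ?Q q" by (rule continuous_map_quotient_topology)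
  have pair_quotient: "quotient_map (prod_topology M M) (prod_topology ?Q ?Q) (\<lambda>(a, b). (q a, q b))"
    using qc surj tsM open_map_prod[OF quotient_hom_open_map[OF gt G q] quotient_hom_open_map[OF gt G q]]
    by (subst continuous_open_quotient_map) (auto simp: continuous_map_prod_top image_paired_Times)
  have "continuous_map (prod_topology ?Q ?Q) ?Q (\<lambda>(a, b). a \<otimes>\<^bsub>G\<^esub> b)"
  proof (rule continuous_compose_quotient_map[OF pair_quotient])
    show "continuous_map (prod_topology M M) ?Q ((\<lambda>(a, b). a \<otimes>\<^bsub>G\<^esub> b) \<circ> (\<lambda>(a, b). (q a, q b)))"
      using continuous_map_compose[OF group_topology_mult[OF gt] qc]
      by (rule continuous_map_eq) (auto simp: tsM)
  qed
  moreover have "continuous_map ?Q ?Q (\<lambda>a. inv\<^bsub>G\<^esub> a)"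
  proof (rule continuous_compose_quotient_map[OF quotient_map_quotient_topology])
    show "continuous_map M ?Q ((\<lambda>a. inv\<^bsub>G\<^esub> a) \<circ> q)"
      using continuous_map_compose[OF group_topology_inv[OF gt] qc]
      by (rule continuous_map_eq) (auto simp: tsM)
  qed
  ultimately show ?thesis using G surj tsM by (simp add: group_topology_def)
qed

lemma pullback_group_topology:
  assumes G: "group G" and gt: "group_topology H S" and h: "h \<in> hom G H"
  shows "group_topology G (pullback_topology (carrier G) h S)"
proof -
  let ?P = "pullback_topology (carrier G) h S"
  interpret G: group G by (rule G)
  interpret H: group H by (rule group_topology_group[OF gt])
  interpret h: group_hom G H h using h by (simp add: group_hom_def group_hom_axioms_def G H.group_axioms)
  have tsS: "topspace S = carrier H" by (rule group_topology_topspace[OF gt])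
  have tsP: "topspace ?P = carrier G" using tsS by (auto simp: topspace_pullback_topology)
  have hc: "continuous_map ?P S h"
    using continuous_map_pullback[OF continuous_map_id, of "carrier G" h S] by simp
  have "continuous_map (prod_topology ?P ?P) ?P (\<lambda>(a, b). a \<otimes>\<^bsub>G\<^esub> b)"
  proof (rule continuous_map_pullback')
    have "continuous_map (prod_topology ?P ?P) (prod_topology S S) (\<lambda>(a, b). (h a, h b))"
      using hc by (simp add: continuous_map_prod_top)
    from continuous_map_compose[OF this group_topology_mult[OF gt]]
    show "continuous_map (prod_topology ?P ?P) S (h \<circ> (\<lambda>(a, b). a \<otimes>\<^bsub>G\<^esub> b))"
      by (rule continuous_map_eq) (auto simp: tsP)
  qed (use tsP in auto)
  moreover have "continuous_map ?P ?P (\<lambda>a. inv\<^bsub>G\<^esub> a)"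
  proof (rule continuous_map_pullback')
    from continuous_map_compose[OF hc group_topology_inv[OF gt]]
    show "continuous_map ?P S (h \<circ> (\<lambda>a. inv\<^bsub>G\<^esub> a))"
      by (rule continuous_map_eq) (auto simp: tsP)
  qed (use tsP in auto)
  ultimately show ?thesis using G tsP by (simp add: group_topology_def)
qed

section \<open>The Markov free topological group\<close>

text \<open>The supremum of a family of topologies on a set \<open>A\<close>: the topology generated
  by all their open sets (and \<open>A\<close> itself, so that the empty family is covered).\<close>
definition sup_topology :: "'a set \<Rightarrow> 'a topology set \<Rightarrow> 'a topology" where
  "sup_topology A \<T> = topology_generated_by (insert A {U. \<exists>T\<in>\<T>. openin T U})"

context
  fixes A :: "'a set" and \<T> :: "'a topology set"
  assumes topspaces: "\<And>T. T \<in> \<T> \<Longrightarrow> topspace T = A"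
begin

lemma topspace_sup_topology: "topspace (sup_topology A \<T>) = A"
  using openin_subset topspaces by (fastforce simp: sup_topology_def)

lemma sup_topology_finer: "T \<in> \<T> \<Longrightarrow> openin T U \<Longrightarrow> openin (sup_topology A \<T>) U"
  unfolding sup_topology_def openin_topology_generated_by_iff
  by (rule generate_topology_on.Basis) auto

lemma sup_topology_id_continuous: "T \<in> \<T> \<Longrightarrow> continuous_map (sup_topology A \<T>) T id"
  using topology_finer_continuous_id sup_topology_finer topspaces topspace_sup_topology by metis

lemma continuous_map_into_sup_topology:
  assumes f: "f \<in> topspace Z \<rightarrow> A" and cont: "\<And>T. T \<in> \<T> \<Longrightarrow> continuous_map Z T f"
  shows "continuous_map Z (sup_topology A \<T>) f"
  unfolding sup_topology_def
proof (rule continuous_on_generated_topo)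
  fix U assume "U \<in> insert A {U. \<exists>T\<in>\<T>. openin T U}"
  moreover have "f -` A \<inter> topspace Z = topspace Z" using f by auto
  ultimately show "openin Z (f -` U \<inter> topspace Z)"
    using cont by (auto simp: continuous_map_def Int_commute vimage_def Collect_conj_eq)
qed (use f in auto)

end

text \<open>The Markov topology is the supremum of all group topologies on the free group
  making the generators continuous, and it belongs to this family.\<close>
definition markov_family :: "'a topology \<Rightarrow> ('a \<times> bool) list topology set" where
  "markov_family S = {T. group_topology (free_group (topspace S)) T \<and> continuous_map S T free_gen}"

lemma markov_family_topspace:
  "T \<in> markov_family S \<Longrightarrow> topspace T = carrier (free_group (topspace S))"
  by (simp add: markov_family_def group_topology_def)

lemma markov_sup_in_family:
  "sup_topology (carrier (free_group (topspace S))) (markov_family S) \<in> markov_family S"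
proof -
  let ?F = "free_group (topspace S)"
  let ?M = "sup_topology (carrier ?F) (markov_family S)"
  interpret F: group ?F by (rule free_group_is_group)
  note sup = markov_family_topspace[of _ S]
  have tsM: "topspace ?M = carrier ?F" by (rule topspace_sup_topology[OF sup])
  have "continuous_map (prod_topology ?M ?M) ?M (\<lambda>(a, b). a \<otimes>\<^bsub>?F\<^esub> b)"
  proof (rule continuous_map_into_sup_topology[OF sup])
    fix T assume T: "T \<in> markov_family S"
    have "continuous_map (prod_topology ?M ?M) (prod_topology T T) (\<lambda>(a, b). (id a, id b))"
      using sup_topology_id_continuous[OF sup T] continuous_map_prod_top[of ?M ?M T T id id] by blast
    moreover have "group_topology ?F T" using T by (simp add: markov_family_def)
    ultimately show "continuous_map (prod_topology ?M ?M) T (\<lambda>(a, b). a \<otimes>\<^bsub>?F\<^esub> b)"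
      using continuous_map_compose group_topology_mult by (fastforce simp: o_def case_prod_unfold)
  qed (use tsM in auto)
  moreover have "continuous_map ?M ?M (\<lambda>a. inv\<^bsub>?F\<^esub> a)"
  proof (rule continuous_map_into_sup_topology[OF sup])
    fix T assume T: "T \<in> markov_family S"
    have "group_topology ?F T" using T by (simp add: markov_family_def)
    from continuous_map_compose[OF sup_topology_id_continuous[OF sup T] group_topology_inv[OF this]]
    show "continuous_map ?M T (\<lambda>a. inv\<^bsub>?F\<^esub> a)" by (simp add: o_def)
  qed (use tsM in auto)
  moreover have "continuous_map S ?M free_gen"
    by (rule continuous_map_into_sup_topology[OF sup])
       (auto simp: markov_family_def free_gen_carrier)
  ultimately show ?thesis
    using free_group_is_group tsM by (simp add: markov_family_def group_topology_def)
qed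

lemma markov_sup_finer:
  "T \<in> markov_family S \<Longrightarrow> openin T U
   \<Longrightarrow> openin (sup_topology (carrier (free_group (topspace S))) (markov_family S)) U"
  by (rule sup_topology_finer[where \<T>="markov_family S"]) (auto simp: markov_family_topspace)

lemma markov_topology_eq:
  "markov_topology S = sup_topology (carrier (free_group (topspace S))) (markov_family S)"
  unfolding markov_topology_def
proof (rule the_equality)
  show "group_topology (free_group (topspace S)) (sup_topology (carrier (free_group (topspace S))) (markov_family S)) \<and>
    continuous_map S (sup_topology (carrier (free_group (topspace S))) (markov_family S)) free_gen \<and>
    (\<forall>T'. group_topology (free_group (topspace S)) T' \<and> continuous_map S T' free_gen \<longrightarrow>
          (\<forall>U. openin T' U \<longrightarrow> openin (sup_topology (carrier (free_group (topspace S))) (markov_family S)) U))"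
    using markov_sup_in_family[of S] markov_sup_finer[of _ S] by (auto simp: markov_family_def)
  fix T assume T: "group_topology (free_group (topspace S)) T \<and> continuous_map S T free_gen \<and>
    (\<forall>T'. group_topology (free_group (topspace S)) T' \<and> continuous_map S T' free_gen \<longrightarrow>
          (\<forall>U. openin T' U \<longrightarrow> openin T U))"
  then have "T \<in> markov_family S" by (simp add: markov_family_def)
  then show "T = sup_topology (carrier (free_group (topspace S))) (markov_family S)"
    unfolding topology_eq
    using T markov_sup_in_family[of S] markov_sup_finer[OF \<open>T \<in> markov_family S\<close>]
    by (auto simp: markov_family_def)
qed

lemma markov_group_topology: "group_topology (free_group (topspace S)) (markov_topology S)"
  and markov_gen_continuous: "continuous_map S (markov_topology S) free_gen"
  using markov_sup_in_family[of S] by (auto simp: markov_topology_eq markov_family_def)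

lemma markov_finest:
  "group_topology (free_group (topspace S)) T \<Longrightarrow> continuous_map S T free_gen \<Longrightarrow> openin T U
   \<Longrightarrow> openin (markov_topology S) U"
  unfolding markov_topology_eq by (rule markov_sup_finer) (simp add: markov_family_def)

section \<open>The functor \<open>\<tau>\<close>\<close>

context
  fixes G (structure) and T
  assumes G: "group G" and tsT: "topspace T = carrier G"
begin

lemma tau_group_topology: "group_topology G (tau_topology G T)"
  unfolding tau_topology_def
  using markov_group_topology[of T] group.mult_word_hom[OF G] group.mult_word_surj[OF G] G tsT
  by (intro quotient_group_topology) auto

lemma tau_coarser: "continuous_map T (tau_topology G T) (\<lambda>x. x)"
proof -
  have "continuous_map T (tau_topology G T) (mult_word G \<circ> free_gen)"
    unfolding tau_topology_def
    by (rule continuous_map_compose[OF markov_gen_continuous continuous_map_quotient_topology])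
  then show ?thesis by (rule continuous_map_eq) (simp add: group.mult_word_gen[OF G] tsT)
qed

text \<open>If \<open>S\<close> is a group topology coarser than \<open>T\<close>, then \<open>m\<^sub>G\<close> is continuous from
  \<open>F\<^sub>M(T)\<close> to \<open>S\<close>, by the maximality of the Markov topology applied to the pullback
  of \<open>S\<close> along \<open>m\<^sub>G\<close>; hence \<open>S\<close> is coarser than the quotient topology \<open>\<tau>(G)\<close>.\<close>
lemma tau_universal:
  assumes S: "group_topology G S" and id: "continuous_map T S (\<lambda>x. x)"
  shows "continuous_map (tau_topology G T) S (\<lambda>x. x)"
proof -
  let ?F = "free_group (carrier G)"
  let ?P = "pullback_topology (carrier ?F) (mult_word G) S"
  have hom: "mult_word G \<in> hom ?F G" by (rule group.mult_word_hom[OF G])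
  have tsM: "topspace (markov_topology T) = carrier ?F"
    using group_topology_topspace[OF markov_group_topology[of T]] tsT by simp
  have "continuous_map T ?P free_gen"
  proof (rule continuous_map_pullback')
    show "continuous_map T S (mult_word G \<circ> free_gen)"
      using id by (rule continuous_map_eq) (simp add: group.mult_word_gen[OF G] tsT)
  qed (use tsT free_gen_carrier in auto)
  then have finer: "openin ?P V \<Longrightarrow> openin (markov_topology T) V" for V
    using markov_finest[of T ?P] pullback_group_topology[OF free_group_is_group S hom] tsT by auto
  have "continuous_map (markov_topology T) S (mult_word G)"
    unfolding continuous_map_def
  proof (intro conjI allI impI)
    show "mult_word G \<in> topspace (markov_topology T) \<rightarrow> topspace S"
      using group_topology_topspace[OF S] hom tsM by (auto simp: hom_def)
    fix U assume "openin S U"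
    then have "openin ?P (mult_word G -` U \<inter> carrier ?F)"
      by (auto simp: openin_pullback_topology)
    moreover have "{x \<in> topspace (markov_topology T). mult_word G x \<in> U} = mult_word G -` U \<inter> carrier ?F"
      using tsM by auto
    ultimately show "openin (markov_topology T) {x \<in> topspace (markov_topology T). mult_word G x \<in> U}"
      using finer by simp
  qed
  then show ?thesis
    unfolding tau_topology_def
    by (rule continuous_compose_quotient_map[OF quotient_map_quotient_topology, unfolded o_def])
qed

end

text \<open>Functoriality: a continuous homomorphism stays continuous for the
  \<open>\<tau>\<close>-topologies (apply the universal property to the pullback of \<open>\<tau>(H)\<close>).\<close>
lemma tau_functor:
  assumes G: "group G" and H: "group H" and tsG: "topspace TG = carrier G"
    and tsH: "topspace TH = carrier H" and h: "h \<in> hom G H" and hc: "continuous_map TG TH h"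
  shows "continuous_map (tau_topology G TG) (tau_topology H TH) h"
proof -
  let ?S = "pullback_topology (carrier G) h (tau_topology H TH)"
  have S: "group_topology G ?S"
    by (rule pullback_group_topology[OF G tau_group_topology[OF H tsH] h])
  have "continuous_map TG ?S (\<lambda>x. x)"
  proof (rule continuous_map_pullback')
    show "continuous_map TG (tau_topology H TH) (h \<circ> (\<lambda>x. x))"
      using continuous_map_compose[OF hc tau_coarser[OF H tsH]] by (simp add: o_def)
  qed (use tsG in auto)
  then have "continuous_map (tau_topology G TG) ?S (\<lambda>x. x)"
    by (rule tau_universal[OF G tsG S])
  from continuous_map_compose[OF this continuous_map_pullback[OF continuous_map_id]]
  show ?thesis by (simp add: o_def)
qed

section \<open>The loop space\<close>

definition loop_subbasic :: "'a topology \<Rightarrow> 'a \<Rightarrow> (real \<Rightarrow> 'a) set set" where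
  "loop_subbasic X x = {{\<alpha> \<in> loops X x. \<alpha> ` K \<subseteq> W} | K W.
                compactin (top_of_set {0..1::real}) K \<and> openin X W}"

definition loop_basic :: "'a topology \<Rightarrow> 'a \<Rightarrow> (real \<Rightarrow> 'a) set \<Rightarrow> bool" where
  "loop_basic X x V \<longleftrightarrow> (\<exists>\<F>. finite \<F> \<and> \<F> \<subseteq> loop_subbasic X x \<and> V = loops X x \<inter> \<Inter>\<F>)"

lemma loop_basic_Int: "loop_basic X x S \<Longrightarrow> loop_basic X x T \<Longrightarrow> loop_basic X x (S \<inter> T)"
  unfolding loop_basic_def
proof (elim exE conjE)
  fix F1 F2 assume "finite F1" "F1 \<subseteq> loop_subbasic X x" "S = loops X x \<inter> \<Inter>F1"
    "finite F2" "F2 \<subseteq> loop_subbasic X x" "T = loops X x \<inter> \<Inter>F2"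
  then show "\<exists>\<F>. finite \<F> \<and> \<F> \<subseteq> loop_subbasic X x \<and> S \<inter> T = loops X x \<inter> \<Inter>\<F>"
    by (intro exI[of _ "F1 \<union> F2"]) auto
qed

lemma openin_loop_space: "openin (loop_space X x) = arbitrary union_of loop_basic X x"
proof -
  have "loop_space X x = topology (arbitrary union_of loop_basic X x)"
    unfolding loop_space_def loop_basic_def loop_subbasic_def union_of_def arbitrary_def
    by (rule arg_cong[where f=topology]) (auto simp: fun_eq_iff)
  then show ?thesis
    using topology_inverse'[OF istopology_base[of "loop_basic X x"]] loop_basic_Int by metis
qed

lemma topspace_loop_space [simp]: "topspace (loop_space X x) = loops X x"
proof
  have "loop_basic X x (loops X x)" unfolding loop_basic_def by (intro exI[of _ "{}"]) auto
  then have "openin (loop_space X x) (loops X x)"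
    unfolding openin_loop_space by (rule arbitrary_union_of_inc)
  then show "loops X x \<subseteq> topspace (loop_space X x)" by (rule openin_subset)
  show "topspace (loop_space X x) \<subseteq> loops X x"
    unfolding topspace_def openin_loop_space union_of_def loop_basic_def by auto
qed

lemma loops_compose:
  "\<alpha> \<in> loops X x \<Longrightarrow> continuous_map X Z f \<Longrightarrow> f x = z \<Longrightarrow> f \<circ> \<alpha> \<in> loops Z z"
  by (auto simp: loops_def pathin_compose)

lemma loops_const: "x \<in> topspace X \<Longrightarrow> (\<lambda>t. x) \<in> loops X x"
  by (simp add: loops_def)

text \<open>Composition with a based map is continuous on loop spaces: the preimage of the
  subbasic set \<open>{\<gamma>. \<gamma> K \<subseteq> W}\<close> is the subbasic set \<open>{\<alpha>. \<alpha> K \<subseteq> f\<^sup>-\<^sup>1 W}\<close>.\<close>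
lemma loop_space_compose:
  assumes f: "continuous_map X Z f" and fx: "f x = z"
  shows "continuous_map (loop_space X x) (loop_space Z z) (\<lambda>\<alpha>. f \<circ> \<alpha>)"
proof (rule continuous_map_into_topology_base[OF openin_loop_space])
  show "f \<circ> \<alpha> \<in> topspace (loop_space Z z)" if "\<alpha> \<in> topspace (loop_space X x)" for \<alpha>
    using that loops_compose[OF _ f fx] by simp
  fix V assume "loop_basic Z z V"
  then obtain \<F> where F: "finite \<F>" "\<F> \<subseteq> loop_subbasic Z z" "V = loops Z z \<inter> \<Inter>\<F>"
    unfolding loop_basic_def by auto
  define pre where "pre S = {\<alpha> \<in> loops X x. f \<circ> \<alpha> \<in> S}" for S
  have "pre S \<in> loop_subbasic X x" if S: "S \<in> \<F>" for S
  proof -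
    obtain K W where KW: "S = {\<gamma> \<in> loops Z z. \<gamma> ` K \<subseteq> W}"
      "compactin (top_of_set {0..1::real}) K" "openin Z W"
      using S F(2) unfolding loop_subbasic_def by auto
    have K: "K \<subseteq> {0..1}" using compactin_subset_topspace[OF KW(2)] by simp
    have "\<alpha> ` K \<subseteq> topspace X" if "\<alpha> \<in> loops X x" for \<alpha>
      using that K path_image_subset_topspace[of X \<alpha>] by (auto simp: loops_def)
    then have "pre S = {\<alpha> \<in> loops X x. \<alpha> ` K \<subseteq> {y \<in> topspace X. f y \<in> W}}"
      unfolding pre_def KW(1) using loops_compose[OF _ f fx] by auto
    moreover have "openin X {y \<in> topspace X. f y \<in> W}"
      using f KW(3) by (simp add: continuous_map_def)
    ultimately show ?thesis unfolding loop_subbasic_def using KW(2) by blast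
  qed
  then have "loop_basic X x (loops X x \<inter> \<Inter>(pre ` \<F>))"
    unfolding loop_basic_def using F(1) by blast
  moreover have "{\<alpha> \<in> topspace (loop_space X x). f \<circ> \<alpha> \<in> V} = loops X x \<inter> \<Inter>(pre ` \<F>)"
    unfolding F(3) pre_def using loops_compose[OF _ f fx] by auto
  ultimately show "openin (loop_space X x) {\<alpha> \<in> topspace (loop_space X x). f \<circ> \<alpha> \<in> V}"
    unfolding openin_loop_space by (simp add: arbitrary_union_of_inc)
qed

section \<open>Loop homotopy and the fundamental group\<close>

lemma loop_homotopic_refl: "\<alpha> \<in> loops X x \<Longrightarrow> loop_homotopic X x \<alpha> \<alpha>"
  by (simp add: loop_homotopic_def loops_def pathin_def)

lemma loop_homotopic_sym: "loop_homotopic X x \<alpha> \<beta> \<Longrightarrow> loop_homotopic X x \<beta> \<alpha>"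
  unfolding loop_homotopic_def by (rule homotopic_with_symD)

lemma loop_homotopic_trans:
  "loop_homotopic X x \<alpha> \<beta> \<Longrightarrow> loop_homotopic X x \<beta> \<gamma> \<Longrightarrow> loop_homotopic X x \<alpha> \<gamma>"
  unfolding loop_homotopic_def by (rule homotopic_with_trans)

text \<open>Homotopies only see the loops on \<open>[0, 1]\<close>.\<close>
lemma loop_homotopic_eq:
  assumes "loop_homotopic X x \<alpha> \<beta>"
    and "\<And>t. t \<in> {0..1} \<Longrightarrow> \<alpha>' t = \<alpha> t" "\<And>t. t \<in> {0..1} \<Longrightarrow> \<beta>' t = \<beta> t"
  shows "loop_homotopic X x \<alpha>' \<beta>'"
  using assms unfolding loop_homotopic_def
  by (intro homotopic_with_eq[OF assms(1)[unfolded loop_homotopic_def]]) auto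

lemma loop_homotopic_compose:
  assumes "loop_homotopic X x \<alpha> \<beta>" "continuous_map X Z f" "f x = z"
  shows "loop_homotopic Z z (f \<circ> \<alpha>) (f \<circ> \<beta>)"
  using assms unfolding loop_homotopic_def
  by (intro homotopic_with_compose_continuous_map_left[OF assms(1)[unfolded loop_homotopic_def] assms(2)]) auto

lemma loop_homotopic_pair:
  assumes "loop_homotopic X x0 a a'" "loop_homotopic Y y0 b b'"
  shows "loop_homotopic (prod_topology X Y) (x0, y0) (\<lambda>t. (a t, b t)) (\<lambda>t. (a' t, b' t))"
proof -
  let ?I = "top_of_set {0..1::real}"
  obtain h1 where h1: "continuous_map (prod_topology ?I ?I) X h1"
    "\<forall>t. h1 (0, t) = a t" "\<forall>t. h1 (1, t) = a' t" "\<forall>s\<in>{0..1}. h1 (s, 0) = x0 \<and> h1 (s, 1) = x0"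
    using assms(1) unfolding loop_homotopic_def homotopic_with_def by blast
  obtain h2 where h2: "continuous_map (prod_topology ?I ?I) Y h2"
    "\<forall>t. h2 (0, t) = b t" "\<forall>t. h2 (1, t) = b' t" "\<forall>s\<in>{0..1}. h2 (s, 0) = y0 \<and> h2 (s, 1) = y0"
    using assms(2) unfolding loop_homotopic_def homotopic_with_def by blast
  show ?thesis
    unfolding loop_homotopic_def homotopic_with_def
    by (rule exI[of _ "\<lambda>z. (h1 z, h2 z)"]) (use h1 h2 in \<open>auto intro: continuous_map_pairedI\<close>)
qed

lemma loop_class_mem: "\<alpha> \<in> loops X x \<Longrightarrow> \<alpha> \<in> loop_class X x \<alpha>"
  by (simp add: loop_class_def loop_homotopic_refl)

lemma loop_class_eqI: "loop_homotopic X x \<alpha> \<beta> \<Longrightarrow> loop_class X x \<alpha> = loop_class X x \<beta>"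
  unfolding loop_class_def by (meson loop_homotopic_sym loop_homotopic_trans)

lemma loop_join_compose: "f \<circ> loop_join \<alpha> \<beta> = loop_join (f \<circ> \<alpha>) (f \<circ> \<beta>)"
  by (simp add: fun_eq_iff loop_join_def)

lemma loop_join_loops:
  assumes a: "\<alpha> \<in> loops X x" and b: "\<beta> \<in> loops X x"
  shows "loop_join \<alpha> \<beta> \<in> loops X x"
proof -
  let ?T01 = "top_of_set {0..1::real}"
  have g1: "continuous_map ?T01 X \<alpha>" and g2: "continuous_map ?T01 X \<beta>"
    and e: "\<alpha> 0 = x" "\<alpha> 1 = x" "\<beta> 0 = x" "\<beta> 1 = x"
    using a b by (auto simp: loops_def pathin_def)
  let ?g = "\<lambda>x. if x \<le> 1/2 then (\<alpha> \<circ> (\<lambda>t. 2 * t)) x else (\<beta> \<circ> (\<lambda>t. 2 * t -1)) x"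
  have "continuous_map ?T01 X ?g"
  proof (intro continuous_map_cases_le continuous_map_compose, force, force)
    show "continuous_map (subtopology ?T01 {x \<in> topspace ?T01. x \<le> 1/2}) ?T01 ((*) 2)"
      by (auto simp: continuous_map_in_subtopology continuous_map_from_subtopology)
    have "continuous_map
           (subtopology (top_of_set {0..1}) {x. 0 \<le> x \<and> x \<le> 1 \<and> 1 \<le> x * 2})
           euclideanreal (\<lambda>t. 2 * t - 1)"
      by (intro continuous_intros) (force intro: continuous_map_from_subtopology)
    then show "continuous_map (subtopology ?T01 {x \<in> topspace ?T01. 1/2 \<le> x}) ?T01 (\<lambda>t. 2 * t - 1)"
      by (force simp: continuous_map_in_subtopology)
    show "(\<alpha> \<circ> (*) 2) x = (\<beta> \<circ> (\<lambda>t. 2 * t - 1)) x" if "x \<in> topspace ?T01" "x = 1/2" for x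
    proof -
      have "2 * x = 1" using that by simp
      then show ?thesis using e by simp
    qed
  qed (auto simp: g1 g2)
  moreover have "?g = loop_join \<alpha> \<beta>" by (simp add: loop_join_def fun_eq_iff)
  ultimately show ?thesis using e by (simp add: loops_def pathin_def loop_join_def)
qed

lemma loop_join_homotopic:
  assumes ha: "loop_homotopic X x \<alpha> \<alpha>'" and hb: "loop_homotopic X x \<beta> \<beta>'"
  shows "loop_homotopic X x (loop_join \<alpha> \<beta>) (loop_join \<alpha>' \<beta>')"
proof -
  let ?I = "top_of_set {0..1::real}"
  let ?X01 = "prod_topology ?I ?I"
  obtain k1 k2
    where contk1: "continuous_map ?X01 X k1" and contk2: "continuous_map ?X01 X k2"
      and k: "\<forall>t. k1 (0, t) = \<alpha> t" "\<forall>t. k1 (1, t) = \<alpha>' t" "\<forall>t. k2 (0, t) = \<beta> t" "\<forall>t. k2 (1, t) = \<beta>' t"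
      and P: "\<forall>s\<in>{0..1}. k1 (s, 0) = x \<and> k1 (s, 1) = x" "\<forall>s\<in>{0..1}. k2 (s, 0) = x \<and> k2 (s, 1) = x"
    using ha hb by (auto simp: loop_homotopic_def homotopic_with_def)
  define k where "k \<equiv> \<lambda>y. if snd y \<le> 1/2
                             then (k1 \<circ> (\<lambda>y. (fst y, 2 * snd y))) y
                             else (k2 \<circ> (\<lambda>y. (fst y, 2 * snd y - 1))) y"
  show ?thesis
    unfolding loop_homotopic_def homotopic_with_def
  proof (intro exI conjI)
    show "continuous_map ?X01 X k"
      unfolding k_def
    proof (rule continuous_map_cases_le)
      show snd: "continuous_map ?X01 euclideanreal snd"
        using continuous_map_snd continuous_map_in_subtopology by blast
      show "continuous_map ?X01 euclideanreal (\<lambda>x. 1/2)"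
        by simp
      have fst: "continuous_map ?X01 euclideanreal fst"
        using continuous_map_fst continuous_map_in_subtopology by blast
      show "continuous_map (subtopology ?X01 {y \<in> topspace ?X01. snd y \<le> 1/2}) X
               (k1 \<circ> (\<lambda>y. (fst y, 2 * snd y)))"
        apply (intro fst snd continuous_map_compose [OF _ contk1] continuous_intros continuous_map_into_subtopology continuous_map_from_subtopology | simp)+
        by (force simp: prod_topology_subtopology)
      show "continuous_map (subtopology ?X01 {y \<in> topspace ?X01. 1/2 \<le> snd y}) X
               (k2 \<circ> (\<lambda>y. (fst y, 2 * snd y - 1)))"
        apply (intro fst snd continuous_map_compose [OF _ contk2] continuous_intros continuous_map_into_subtopology continuous_map_from_subtopology | simp)+
        by (force simp: prod_topology_subtopology)
      show "(k1 \<circ> (\<lambda>y. (fst y, 2 * snd y))) y = (k2 \<circ> (\<lambda>y. (fst y, 2 * snd y - 1))) y"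
        if "y \<in> topspace ?X01" and "snd y = 1/2" for y
      proof -
        have "2 * snd y = 1" "fst y \<in> {0..1}" using that by auto
        then show ?thesis using P by simp
      qed
    qed
    show "\<forall>t. k (0, t) = loop_join \<alpha> \<beta> t"
      by (simp add: k k_def loop_join_def)
    show "\<forall>t. k (1, t) = loop_join \<alpha>' \<beta>' t"
      by (simp add: k k_def loop_join_def)
    show "\<forall>s\<in>{0..1}. (\<lambda>t. k (s, t)) 0 = x \<and> (\<lambda>t. k (s, t)) 1 = x"
      using P by (simp add: k_def)
  qed
qed

text \<open>Reparametrisation: \<open>\<alpha> \<circ> r\<close> and \<open>\<alpha> \<circ> r'\<close> are homotopic for reparametrisations
  \<open>r, r'\<close> of \<open>[0, 1]\<close> with the same ends, via the straight-line homotopy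
  \<open>(1 - s) r + s r'\<close>.  The groupoid laws for concatenation are instances.\<close>
lemma loop_homotopic_reparam:
  assumes a: "\<alpha> \<in> loops X x"
    and r: "continuous_on {0..1} r" "r ` {0..1} \<subseteq> {0..1}"
    and r': "continuous_on {0..1} r'" "r' ` {0..1} \<subseteq> {0..1}"
    and ends: "r 0 = r' 0" "r 1 = r' 1" "\<alpha> (r 0) = x" "\<alpha> (r 1) = x"
    and p: "\<And>t. t \<in> {0..1} \<Longrightarrow> p t = \<alpha> (r t)" and q: "\<And>t. t \<in> {0..1} \<Longrightarrow> q t = \<alpha> (r' t)"
  shows "loop_homotopic X x p q"
proof -
  let ?I = "top_of_set {0..1::real}"
  define k where "k = (\<lambda>y::real \<times> real. (1 - fst y) * r (snd y) + fst y * r' (snd y))"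
  have "continuous_on ({0..1} \<times> {0..1}) (\<lambda>y::real\<times>real. r (snd y))"
    and "continuous_on ({0..1} \<times> {0..1}) (\<lambda>y::real\<times>real. r' (snd y))"
    by (rule continuous_on_compose2[OF r(1) continuous_on_snd] continuous_on_compose2[OF r'(1) continuous_on_snd]; auto)+
  then have kc: "continuous_on ({0..1} \<times> {0..1}) k"
    unfolding k_def by (intro continuous_intros)
  have "k (s, t) \<in> {0..1}" if "s \<in> {0..1}" "t \<in> {0..1}" for s t
  proof -
    have "r t \<in> {0..1}" "r' t \<in> {0..1}" using r(2) r'(2) that by blast+
    then have "0 \<le> (1 - s) * r t + s * r' t" "(1 - s) * r t + s * r' t \<le> (1 - s) * 1 + s * 1"
      using that by (auto intro!: add_mono mult_left_mono simp del: mult_1_right)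
    then show ?thesis by (simp add: k_def)
  qed
  then have "continuous_map (prod_topology ?I ?I) ?I k"
    using kc by (auto simp: continuous_map_in_subtopology)
  then have "continuous_map (prod_topology ?I ?I) X (\<alpha> \<circ> k)"
    using a by (intro continuous_map_compose) (auto simp: loops_def pathin_def)
  moreover have "(1 - s) * c + s * c = c" for s c :: real by (simp add: algebra_simps)
  ultimately have "loop_homotopic X x (\<alpha> \<circ> r) (\<alpha> \<circ> r')"
    unfolding loop_homotopic_def homotopic_with_def using ends
    by (intro exI[of _ "\<alpha> \<circ> k"]) (simp add: k_def)
  then show ?thesis by (rule loop_homotopic_eq) (simp_all add: p q)
qed

lemma loop_join_const_left: assumes a: "\<alpha> \<in> loops X x" shows "loop_homotopic X x (loop_join (\<lambda>t. x) \<alpha>) \<alpha>"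
proof (rule loop_homotopic_reparam[OF a, of "\<lambda>t. max 0 (2*t - 1)" "\<lambda>t. t"])
  show "continuous_on {0..1} (\<lambda>t::real. max 0 (2*t - 1))" by (intro continuous_intros)
  show "(\<lambda>t::real. max 0 (2*t - 1)) ` {0..1} \<subseteq> {0..1}" by auto
  show "loop_join (\<lambda>t. x) \<alpha> t = \<alpha> (max 0 (2 * t - 1))" if "t \<in> {0..1}" for t
  proof (cases "t \<le> 1/2")
    case True
    then have "max 0 (2 * t - 1) = 0" by simp
    then show ?thesis using a True by (simp add: loop_join_def loops_def)
  next
    case False
    then have "max 0 (2 * t - 1) = 2 * t - 1" by simp
    then show ?thesis using a False by (simp add: loop_join_def loops_def)
  qed
qed (use a in \<open>auto simp: loops_def\<close>)

lemma loop_join_const_right: assumes a: "\<alpha> \<in> loops X x" shows "loop_homotopic X x (loop_join \<alpha> (\<lambda>t. x)) \<alpha>"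
proof (rule loop_homotopic_reparam[OF a, of "\<lambda>t. min 1 (2*t)" "\<lambda>t. t"])
  show "continuous_on {0..1} (\<lambda>t::real. min 1 (2*t))" by (intro continuous_intros)
  show "(\<lambda>t::real. min 1 (2*t)) ` {0..1} \<subseteq> {0..1}" by auto
  show "loop_join \<alpha> (\<lambda>t. x) t = \<alpha> (min 1 (2 * t))" if "t \<in> {0..1}" for t
  proof (cases "t \<le> 1/2")
    case True
    then have "min 1 (2 * t) = 2 * t" by simp
    then show ?thesis using a True by (simp add: loop_join_def loops_def)
  next
    case False
    then have "min 1 (2 * t) = 1" by simp
    then show ?thesis using a False by (simp add: loop_join_def loops_def)
  qed
qed (use a in \<open>auto simp: loops_def\<close>)

lemma loop_join_reverse: assumes a: "\<alpha> \<in> loops X x"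
  shows "loop_homotopic X x (loop_join (\<lambda>t. \<alpha> (1 - t)) \<alpha>) (\<lambda>t. x)"
proof (rule loop_homotopic_reparam[OF a, of "\<lambda>t. \<bar>2*t - 1\<bar>" "\<lambda>t. 1"])
  show "continuous_on {0..1} (\<lambda>t::real. \<bar>2*t - 1\<bar>)" by (intro continuous_intros)
  show "(\<lambda>t::real. \<bar>2*t - 1\<bar>) ` {0..1} \<subseteq> {0..1}" by auto
  show "loop_join (\<lambda>t. \<alpha> (1 - t)) \<alpha> t = \<alpha> \<bar>2 * t - 1\<bar>" if "t \<in> {0..1}" for t
  proof (cases "t \<le> 1/2")
    case True
    then have "\<bar>2 * t - 1\<bar> = 1 - 2 * t" by simp
    then show ?thesis using True by (simp add: loop_join_def)
  next
    case False
    then have "\<bar>2 * t - 1\<bar> = 2 * t - 1" by simp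
    then show ?thesis using False by (simp add: loop_join_def)
  qed
qed (use a in \<open>auto simp: loops_def\<close>)

lemma loop_join_assoc:
  assumes a: "\<alpha> \<in> loops X x" and b: "\<beta> \<in> loops X x" and c: "\<gamma> \<in> loops X x"
  shows "loop_homotopic X x (loop_join (loop_join \<alpha> \<beta>) \<gamma>) (loop_join \<alpha> (loop_join \<beta> \<gamma>))"
proof -
  let ?c = "loop_join \<alpha> (loop_join \<beta> \<gamma>)"
  let ?r = "\<lambda>t::real. min (2*t) (min (t + 1/4) ((t + 1)/2))"
  have cl: "?c \<in> loops X x" using a b c by (intro loop_join_loops)
  show ?thesis
  proof (rule loop_homotopic_reparam[OF cl, of ?r "\<lambda>t. t"])
    show "continuous_on {0..1} ?r" by (intro continuous_intros) auto
    show "?r ` {0..1} \<subseteq> {0..1}" by (auto simp: min_def)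
    show "loop_join (loop_join \<alpha> \<beta>) \<gamma> t = ?c (?r t)" if "t \<in> {0..1}" for t
    proof -
      consider "t \<le> 1/4" | "1/4 < t" "t \<le> 1/2" | "1/2 < t" by linarith
      then show ?thesis
      proof cases
        case 1 then show ?thesis by (simp add: loop_join_def min_def algebra_simps)
      next
        case 2
        then have "?r t = t + 1/4" by (simp add: min_def)
        then show ?thesis using 2 by (simp add: loop_join_def algebra_simps)
      next
        case 3
        then have "?r t = (t + 1)/2" by (simp add: min_def)
        moreover have "2 * ((t + 1) / 2) - 1 = t" by (simp add: field_simps)
        ultimately show ?thesis using 3 by (simp add: loop_join_def)
      qed
    qed
  qed (use cl in \<open>auto simp: loops_def\<close>)
qed

lemma loop_reverse_loops: assumes "\<alpha> \<in> loops X x" shows "(\<lambda>t. \<alpha> (1 - t)) \<in> loops X x"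
proof -
  have "continuous_map (top_of_set {0..1}) (top_of_set {0..1::real}) (\<lambda>t. 1 - t)"
    by (auto simp: continuous_map_in_subtopology intro!: continuous_intros)
  moreover have "continuous_map (top_of_set {0..1}) X \<alpha>" using assms by (simp add: loops_def pathin_def)
  ultimately have "pathin X (\<alpha> \<circ> (\<lambda>t. 1 - t))"
    unfolding pathin_def by (rule continuous_map_compose)
  then show ?thesis using assms by (simp add: loops_def o_def)
qed

lemma fundamental_group_carrier [simp]:
  "carrier (fundamental_group X x) = loop_class X x ` loops X x"
  by (simp add: fundamental_group_def)

lemma fundamental_group_one [simp]: "\<one>\<^bsub>fundamental_group X x\<^esub> = loop_class X x (\<lambda>t. x)"
  by (simp add: fundamental_group_def)

lemma fundamental_group_mult:
  assumes a: "\<alpha> \<in> loops X x" and b: "\<beta> \<in> loops X x"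
  shows "loop_class X x \<alpha> \<otimes>\<^bsub>fundamental_group X x\<^esub> loop_class X x \<beta> = loop_class X x (loop_join \<alpha> \<beta>)"
proof -
  have "loop_homotopic X x (loop_join \<alpha> \<beta>) \<gamma>"
    if "loop_homotopic X x \<alpha> \<alpha>'" "loop_homotopic X x \<beta> \<beta>'" "loop_homotopic X x (loop_join \<alpha>' \<beta>') \<gamma>"
    for \<alpha>' \<beta>' \<gamma>
    using that loop_homotopic_trans loop_join_homotopic by metis
  then show ?thesis
    using loop_class_mem[OF a] loop_class_mem[OF b]
    by (auto simp: fundamental_group_def loop_class_def)
qed

lemma fundamental_group_is_group:
  assumes x: "x \<in> topspace X"
  shows "group (fundamental_group X x)"
proof (rule groupI)
  let ?G = "fundamental_group X x"
  show "A \<otimes>\<^bsub>?G\<^esub> B \<in> carrier ?G" if "A \<in> carrier ?G" "B \<in> carrier ?G" for A B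
    using that by (auto simp: fundamental_group_mult loop_join_loops)
  show "\<one>\<^bsub>?G\<^esub> \<in> carrier ?G" using loops_const[OF x] by simp
  show "A \<otimes>\<^bsub>?G\<^esub> B \<otimes>\<^bsub>?G\<^esub> C = A \<otimes>\<^bsub>?G\<^esub> (B \<otimes>\<^bsub>?G\<^esub> C)"
    if ABC: "A \<in> carrier ?G" "B \<in> carrier ?G" "C \<in> carrier ?G" for A B C
  proof -
    obtain \<alpha> \<beta> \<gamma> where "\<alpha> \<in> loops X x" "\<beta> \<in> loops X x" "\<gamma> \<in> loops X x"
      and "A = loop_class X x \<alpha>" "B = loop_class X x \<beta>" "C = loop_class X x \<gamma>"
      using ABC by auto
    then show ?thesis
      by (simp add: fundamental_group_mult loop_join_loops loop_class_eqI loop_join_assoc)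
  qed
  show "\<one>\<^bsub>?G\<^esub> \<otimes>\<^bsub>?G\<^esub> A = A" if A: "A \<in> carrier ?G" for A
  proof -
    obtain \<alpha> where "\<alpha> \<in> loops X x" "A = loop_class X x \<alpha>" using A by auto
    then show ?thesis using loops_const[OF x]
      by (simp add: fundamental_group_mult loop_class_eqI loop_join_const_left)
  qed
  show "\<exists>B\<in>carrier ?G. B \<otimes>\<^bsub>?G\<^esub> A = \<one>\<^bsub>?G\<^esub>" if A: "A \<in> carrier ?G" for A
  proof -
    obtain \<alpha> where l: "\<alpha> \<in> loops X x" and A: "A = loop_class X x \<alpha>" using A by auto
    have "loop_class X x (\<lambda>t. \<alpha> (1 - t)) \<otimes>\<^bsub>?G\<^esub> A = \<one>\<^bsub>?G\<^esub>"
      using l loop_reverse_loops[OF l] unfolding A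
      by (simp add: fundamental_group_mult loop_class_eqI loop_join_reverse)
    then show ?thesis using loop_reverse_loops[OF l] by auto
  qed
qed

text \<open>A based map \<open>f : (X, x) \<rightarrow> (Z, z)\<close> induces \<open>f\<^sub>* : \<pi>\<^sub>1(X, x) \<rightarrow> \<pi>\<^sub>1(Z, z)\<close>,
  \<open>f\<^sub>* [\<alpha>] = [f \<circ> \<alpha>]\<close>; it is a homomorphism, continuous for \<open>\<pi>\<^sub>1\<^sup>q\<^sup>t\<^sup>o\<^sup>p\<close> and
  therefore, by functoriality of \<open>\<tau>\<close>, also for \<open>\<pi>\<^sub>1\<^sup>\<tau>\<close>.\<close>
definition induced_hom :: "'a topology \<Rightarrow> 'a \<Rightarrow> 'b topology \<Rightarrow> 'b \<Rightarrow> ('a \<Rightarrow> 'b)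
    \<Rightarrow> (real \<Rightarrow> 'a) set \<Rightarrow> (real \<Rightarrow> 'b) set" where
  "induced_hom X x Z z f A = {\<gamma> \<in> loops Z z. \<exists>\<alpha>\<in>A. loop_homotopic Z z (f \<circ> \<alpha>) \<gamma>}"

lemma induced_hom_class:
  assumes f: "continuous_map X Z f" and fx: "f x = z" and a: "\<alpha> \<in> loops X x"
  shows "induced_hom X x Z z f (loop_class X x \<alpha>) = loop_class Z z (f \<circ> \<alpha>)"
proof -
  have "loop_homotopic Z z (f \<circ> \<alpha>) \<gamma>"
    if "loop_homotopic X x \<alpha> \<alpha>'" "loop_homotopic Z z (f \<circ> \<alpha>') \<gamma>" for \<alpha>' \<gamma>
    using loop_homotopic_trans[OF loop_homotopic_compose[OF that(1) f fx] that(2)] .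
  then show ?thesis
    using loop_class_mem[OF a] by (auto simp: induced_hom_def loop_class_def)
qed

lemma induced_hom_hom:
  assumes f: "continuous_map X Z f" and fx: "f x = z"
  shows "induced_hom X x Z z f \<in> hom (fundamental_group X x) (fundamental_group Z z)"
proof (rule homI)
  fix A assume "A \<in> carrier (fundamental_group X x)"
  then show "induced_hom X x Z z f A \<in> carrier (fundamental_group Z z)"
    by (auto simp: induced_hom_class[OF f fx] loops_compose[OF _ f fx])
next
  fix A B assume "A \<in> carrier (fundamental_group X x)" "B \<in> carrier (fundamental_group X x)"
  then show "induced_hom X x Z z f (A \<otimes>\<^bsub>fundamental_group X x\<^esub> B) =
        induced_hom X x Z z f A \<otimes>\<^bsub>fundamental_group Z z\<^esub> induced_hom X x Z z f B"
    by (auto simp: fundamental_group_mult loop_join_loops induced_hom_class[OF f fx]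
        loops_compose[OF _ f fx] loop_join_compose)
qed

lemma pi1_qtop_topspace [simp]: "topspace (pi1_qtop X x) = carrier (fundamental_group X x)"
  by (simp add: pi1_qtop_def)

lemma induced_hom_qtop_continuous:
  assumes f: "continuous_map X Z f" and fx: "f x = z"
  shows "continuous_map (pi1_qtop X x) (pi1_qtop Z z) (induced_hom X x Z z f)"
  unfolding pi1_qtop_def
proof (rule continuous_compose_quotient_map[OF quotient_map_quotient_topology])
  have "continuous_map (loop_space X x) (quotient_topology (loop_space Z z) (loop_class Z z))
          (loop_class Z z \<circ> (\<lambda>\<alpha>. f \<circ> \<alpha>))"
    by (rule continuous_map_compose[OF loop_space_compose[OF f fx] continuous_map_quotient_topology])
  then show "continuous_map (loop_space X x) (quotient_topology (loop_space Z z) (loop_class Z z))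
          (induced_hom X x Z z f \<circ> loop_class X x)"
    by (rule continuous_map_eq) (simp add: induced_hom_class[OF f fx])
qed

lemma pi1_tau_group_topology:
  "x \<in> topspace X \<Longrightarrow> group_topology (fundamental_group X x) (pi1_tau X x)"
  unfolding pi1_tau_def by (rule tau_group_topology[OF fundamental_group_is_group pi1_qtop_topspace])

lemma pi1_tau_topspace [simp]:
  "x \<in> topspace X \<Longrightarrow> topspace (pi1_tau X x) = carrier (fundamental_group X x)"
  using group_topology_topspace[OF pi1_tau_group_topology] .

lemma induced_hom_tau_continuous:
  assumes x: "x \<in> topspace X" and f: "continuous_map X Z f" and fx: "f x = z"
  shows "continuous_map (pi1_tau X x) (pi1_tau Z z) (induced_hom X x Z z f)"
proof -
  have z: "z \<in> topspace Z" using f x fx by (auto simp: continuous_map_def)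
  show ?thesis unfolding pi1_tau_def
    by (rule tau_functor[OF fundamental_group_is_group[OF x] fundamental_group_is_group[OF z]
          pi1_qtop_topspace pi1_qtop_topspace induced_hom_hom[OF f fx] induced_hom_qtop_continuous[OF f fx]])
qed

section \<open>The fundamental group of a product\<close>

definition pi1_split :: "'a topology \<Rightarrow> 'b topology \<Rightarrow> 'a \<Rightarrow> 'b
    \<Rightarrow> (real \<Rightarrow> 'a \<times> 'b) set \<Rightarrow> (real \<Rightarrow> 'a) set \<times> (real \<Rightarrow> 'b) set" where
  "pi1_split X Y x0 y0 A =
     (induced_hom (prod_topology X Y) (x0, y0) X x0 fst A,
      induced_hom (prod_topology X Y) (x0, y0) Y y0 snd A)"

definition pi1_merge :: "'a topology \<Rightarrow> 'b topology \<Rightarrow> 'a \<Rightarrow> 'b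
    \<Rightarrow> (real \<Rightarrow> 'a) set \<times> (real \<Rightarrow> 'b) set \<Rightarrow> (real \<Rightarrow> 'a \<times> 'b) set" where
  "pi1_merge X Y x0 y0 AB =
     induced_hom X x0 (prod_topology X Y) (x0, y0) (\<lambda>x. (x, y0)) (fst AB)
       \<otimes>\<^bsub>fundamental_group (prod_topology X Y) (x0, y0)\<^esub>
     induced_hom Y y0 (prod_topology X Y) (x0, y0) (\<lambda>y. (x0, y)) (snd AB)"

lemma pi1_split_class:
  "\<gamma> \<in> loops (prod_topology X Y) (x0, y0) \<Longrightarrow>
   pi1_split X Y x0 y0 (loop_class (prod_topology X Y) (x0, y0) \<gamma>) =
     (loop_class X x0 (fst \<circ> \<gamma>), loop_class Y y0 (snd \<circ> \<gamma>))"
  by (simp add: pi1_split_def induced_hom_class[OF continuous_map_fst]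
      induced_hom_class[OF continuous_map_snd])

lemma pi1_split_hom:
  "pi1_split X Y x0 y0 \<in> hom (fundamental_group (prod_topology X Y) (x0, y0))
                              (fundamental_group X x0 \<times>\<times> fundamental_group Y y0)"
proof -
  have "induced_hom (prod_topology X Y) (x0, y0) X x0 fst
          \<in> hom (fundamental_group (prod_topology X Y) (x0, y0)) (fundamental_group X x0)"
   and "induced_hom (prod_topology X Y) (x0, y0) Y y0 snd
          \<in> hom (fundamental_group (prod_topology X Y) (x0, y0)) (fundamental_group Y y0)"
    by (rule induced_hom_hom, rule continuous_map_fst, simp)
       (rule induced_hom_hom, rule continuous_map_snd, simp)
  then show ?thesis
    by (intro homI) (simp_all add: pi1_split_def hom_in_carrier hom_mult mult_DirProd'
        del: fundamental_group_carrier)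
qed

lemma pi1_split_tau_continuous:
  assumes "x0 \<in> topspace X" "y0 \<in> topspace Y"
  shows "continuous_map (pi1_tau (prod_topology X Y) (x0, y0))
           (prod_topology (pi1_tau X x0) (pi1_tau Y y0)) (pi1_split X Y x0 y0)"
  unfolding pi1_split_def using assms
  by (intro continuous_map_pairedI induced_hom_tau_continuous continuous_map_fst continuous_map_snd) simp_all

context
  fixes X :: "'a topology" and Y :: "'b topology" and x0 y0
  assumes x0: "x0 \<in> topspace X" and y0: "y0 \<in> topspace Y"
begin

lemma inclusion_left_continuous: "continuous_map X (prod_topology X Y) (\<lambda>x. (x, y0))"
  using y0 by (intro continuous_map_pairedI) (auto simp: id_def[symmetric])

lemma inclusion_right_continuous: "continuous_map Y (prod_topology X Y) (\<lambda>y. (x0, y))"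
  using x0 by (intro continuous_map_pairedI) (auto simp: id_def[symmetric])

lemma pi1_merge_class:
  assumes "\<alpha> \<in> loops X x0" "\<beta> \<in> loops Y y0"
  shows "pi1_merge X Y x0 y0 (loop_class X x0 \<alpha>, loop_class Y y0 \<beta>) =
           loop_class (prod_topology X Y) (x0, y0) (loop_join (\<lambda>t. (\<alpha> t, y0)) (\<lambda>t. (x0, \<beta> t)))"
  using assms loops_compose[OF assms(1) inclusion_left_continuous]
    loops_compose[OF assms(2) inclusion_right_continuous]
  by (simp add: pi1_merge_def induced_hom_class inclusion_left_continuous
      inclusion_right_continuous fundamental_group_mult o_def)

lemma merged_loop_loops:
  assumes "\<alpha> \<in> loops X x0" "\<beta> \<in> loops Y y0"
  shows "loop_join (\<lambda>t. (\<alpha> t, y0)) (\<lambda>t. (x0, \<beta> t)) \<in> loops (prod_topology X Y) (x0, y0)"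
  using loops_compose[OF assms(1) inclusion_left_continuous]
    loops_compose[OF assms(2) inclusion_right_continuous]
  by (intro loop_join_loops) (simp_all add: o_def)

lemma pi1_merge_carrier:
  assumes "AB \<in> carrier (fundamental_group X x0 \<times>\<times> fundamental_group Y y0)"
  shows "pi1_merge X Y x0 y0 AB \<in> carrier (fundamental_group (prod_topology X Y) (x0, y0))"
  using assms by (auto simp: pi1_merge_class merged_loop_loops)

text \<open>The components of \<open>(\<alpha>, c) \<cdot> (c, \<beta>)\<close> are \<open>\<alpha> \<cdot> c \<simeq> \<alpha>\<close> and \<open>c \<cdot> \<beta> \<simeq> \<beta>\<close>.\<close>
lemma pi1_split_merge:
  assumes "AB \<in> carrier (fundamental_group X x0 \<times>\<times> fundamental_group Y y0)"
  shows "pi1_split X Y x0 y0 (pi1_merge X Y x0 y0 AB) = AB"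
proof -
  obtain \<alpha> \<beta> where l: "\<alpha> \<in> loops X x0" "\<beta> \<in> loops Y y0"
    and AB: "AB = (loop_class X x0 \<alpha>, loop_class Y y0 \<beta>)"
    using assms by auto
  let ?J = "loop_join (\<lambda>t. (\<alpha> t, y0)) (\<lambda>t. (x0, \<beta> t))"
  have "fst \<circ> ?J = loop_join \<alpha> (\<lambda>t. x0)" "snd \<circ> ?J = loop_join (\<lambda>t. y0) \<beta>"
    by (simp_all add: fun_eq_iff loop_join_def)
  then have "pi1_split X Y x0 y0 (loop_class (prod_topology X Y) (x0, y0) ?J) =
      (loop_class X x0 (loop_join \<alpha> (\<lambda>t. x0)), loop_class Y y0 (loop_join (\<lambda>t. y0) \<beta>))"
    using pi1_split_class[OF merged_loop_loops[OF l]] by simp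
  also have "\<dots> = AB"
    unfolding AB using loop_join_const_right[OF l(1)] loop_join_const_left[OF l(2)]
    by (simp add: loop_class_eqI)
  finally show ?thesis using l by (simp add: AB pi1_merge_class)
qed

text \<open>Conversely a loop \<open>\<gamma>\<close> in \<open>X \<times> Y\<close> is homotopic, componentwise, to
  \<open>(fst \<circ> \<gamma>, c) \<cdot> (c, snd \<circ> \<gamma>)\<close>.\<close>
lemma pi1_merge_split:
  assumes "A \<in> carrier (fundamental_group (prod_topology X Y) (x0, y0))"
  shows "pi1_merge X Y x0 y0 (pi1_split X Y x0 y0 A) = A"
proof -
  obtain \<gamma> where l: "\<gamma> \<in> loops (prod_topology X Y) (x0, y0)"
    and A: "A = loop_class (prod_topology X Y) (x0, y0) \<gamma>"
    using assms by auto
  have l': "fst \<circ> \<gamma> \<in> loops X x0" "snd \<circ> \<gamma> \<in> loops Y y0"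
    using loops_compose[OF l continuous_map_fst] loops_compose[OF l continuous_map_snd] by auto
  have join: "loop_join (\<lambda>t. ((fst \<circ> \<gamma>) t, y0)) (\<lambda>t. (x0, (snd \<circ> \<gamma>) t)) =
        (\<lambda>t. (loop_join (fst \<circ> \<gamma>) (\<lambda>t. x0) t, loop_join (\<lambda>t. y0) (snd \<circ> \<gamma>) t))"
    by (simp add: fun_eq_iff loop_join_def)
  have pair: "(\<lambda>t. ((fst \<circ> \<gamma>) t, (snd \<circ> \<gamma>) t)) = \<gamma>"
    by (simp add: fun_eq_iff)
  have "loop_homotopic (prod_topology X Y) (x0, y0)
          (loop_join (\<lambda>t. ((fst \<circ> \<gamma>) t, y0)) (\<lambda>t. (x0, (snd \<circ> \<gamma>) t))) \<gamma>"
    using loop_homotopic_pair[OF loop_join_const_right[OF l'(1)] loop_join_const_left[OF l'(2)]]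
    unfolding join pair .
  then have "pi1_merge X Y x0 y0 (loop_class X x0 (fst \<circ> \<gamma>), loop_class Y y0 (snd \<circ> \<gamma>)) = A"
    unfolding A pi1_merge_class[OF l'] by (rule loop_class_eqI)
  then show ?thesis by (simp add: A pi1_split_class[OF l])
qed

lemma pi1_split_iso:
  "pi1_split X Y x0 y0 \<in> iso (fundamental_group (prod_topology X Y) (x0, y0))
                              (fundamental_group X x0 \<times>\<times> fundamental_group Y y0)"
proof (rule isoI[OF pi1_split_hom])
  show "bij_betw (pi1_split X Y x0 y0) (carrier (fundamental_group (prod_topology X Y) (x0, y0)))
          (carrier (fundamental_group X x0 \<times>\<times> fundamental_group Y y0))"
  proof (rule bij_betw_byWitness[where f'="pi1_merge X Y x0 y0"])
    show "pi1_split X Y x0 y0 ` carrier (fundamental_group (prod_topology X Y) (x0, y0))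
            \<subseteq> carrier (fundamental_group X x0 \<times>\<times> fundamental_group Y y0)"
      by (rule image_subsetI, rule hom_in_carrier[OF pi1_split_hom])
    show "pi1_merge X Y x0 y0 ` carrier (fundamental_group X x0 \<times>\<times> fundamental_group Y y0)
            \<subseteq> carrier (fundamental_group (prod_topology X Y) (x0, y0))"
      by (rule image_subsetI, rule pi1_merge_carrier)
    show "\<forall>A\<in>carrier (fundamental_group (prod_topology X Y) (x0, y0)).
            pi1_merge X Y x0 y0 (pi1_split X Y x0 y0 A) = A"
      by (rule ballI, rule pi1_merge_split)
    show "\<forall>AB\<in>carrier (fundamental_group X x0 \<times>\<times> fundamental_group Y y0).
            pi1_split X Y x0 y0 (pi1_merge X Y x0 y0 AB) = AB"
      by (rule ballI, rule pi1_split_merge)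
  qed
qed

text \<open>\<open>\<psi>\<close> is continuous since \<open>(i\<^sub>X)\<^sub>*\<close>, \<open>(i\<^sub>Y)\<^sub>*\<close> are and \<open>\<pi>\<^sub>1\<^sup>\<tau>(X \<times> Y)\<close> is a
  topological group.\<close>
lemma pi1_merge_tau_continuous:
  "continuous_map (prod_topology (pi1_tau X x0) (pi1_tau Y y0))
     (pi1_tau (prod_topology X Y) (x0, y0)) (pi1_merge X Y x0 y0)"
proof -
  let ?P = "pi1_tau (prod_topology X Y) (x0, y0)"
  have "continuous_map (prod_topology (pi1_tau X x0) (pi1_tau Y y0)) (prod_topology ?P ?P)
          (\<lambda>AB. (induced_hom X x0 (prod_topology X Y) (x0, y0) (\<lambda>x. (x, y0)) (fst AB),
                 induced_hom Y y0 (prod_topology X Y) (x0, y0) (\<lambda>y. (x0, y)) (snd AB)))"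
    using x0 y0 inclusion_left_continuous inclusion_right_continuous
    by (intro continuous_map_pairedI continuous_map_compose[OF continuous_map_fst, unfolded o_def]
          continuous_map_compose[OF continuous_map_snd, unfolded o_def] induced_hom_tau_continuous)
       simp_all
  from continuous_map_compose[OF this group_topology_mult[OF pi1_tau_group_topology]] x0 y0
  show ?thesis by (simp add: pi1_merge_def[abs_def] o_def case_prod_unfold)
qed

lemma pi1_split_homeomorphic:
  "homeomorphic_map (pi1_tau (prod_topology X Y) (x0, y0))
     (prod_topology (pi1_tau X x0) (pi1_tau Y y0)) (pi1_split X Y x0 y0)"
  unfolding homeomorphic_map_maps homeomorphic_maps_def
  using pi1_split_tau_continuous[OF x0 y0] pi1_merge_tau_continuous pi1_split_merge pi1_merge_split x0 y0
  by (intro exI[of _ "pi1_merge X Y x0 y0"]) auto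

end

theorem proposition3p18:
  fixes X :: "'a topology" and Y :: "'b topology" and x0 :: 'a and y0 :: 'b
  assumes "x0 \<in> topspace X" and "y0 \<in> topspace Y"
  shows "\<exists>\<phi>. \<phi> \<in> iso (fundamental_group (prod_topology X Y) (x0, y0))
                    (fundamental_group X x0 \<times>\<times> fundamental_group Y y0) \<and>
             homeomorphic_map (pi1_tau (prod_topology X Y) (x0, y0))
                              (prod_topology (pi1_tau X x0) (pi1_tau Y y0)) \<phi> \<and>
             (\<forall>\<gamma> \<in> loops (prod_topology X Y) (x0, y0).
                \<phi> (loop_class (prod_topology X Y) (x0, y0) \<gamma>) =
                  (loop_class X x0 (fst \<circ> \<gamma>), loop_class Y y0 (snd \<circ> \<gamma>)))"
proof (intro exI conjI ballI)
  show "pi1_split X Y x0 y0 \<in> iso (fundamental_group (prod_topology X Y) (x0, y0))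
          (fundamental_group X x0 \<times>\<times> fundamental_group Y y0)"
    by (rule pi1_split_iso[OF assms])
  show "homeomorphic_map (pi1_tau (prod_topology X Y) (x0, y0))
          (prod_topology (pi1_tau X x0) (pi1_tau Y y0)) (pi1_split X Y x0 y0)"
    by (rule pi1_split_homeomorphic[OF assms])
qed (rule pi1_split_class)

end
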